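(* Consider ${\rm APP}=\{{\rm APP}_{\infty,d}\}_{d\in\mathbb N}$ in the worst case setting for the absolute or normalized error criterion. Then EXP-UWT for $\Lambda^{\rm all}$ is equivalent to EXP-UWT for $\Lambda^{\rm std}$.
   Context: $\mathbb T^d=[0,1]^d$ is the torus with Lebesgue measure; $\hat f(\mathbf k)=\int f(\mathbf x)e^{-2\pi i\mathbf k\cdot\mathbf x}d\mathbf x$. For each $d$ let $\omega_d:\mathbb Z^d\to(0,\infty)$ with $\sum_{\mathbf k}\omega_d(\mathbf k)^{-2}<\infty$, and $H^{\omega_d}(\mathbb T^d)$ the Hilbert space of $f\in L_2(\mathbb T^d)$ with $\|f\|^2=\sum_{\mathbf k}|\hat f(\mathbf k)|^2\omega_d(\mathbf k)^2<\infty$. ${\rm APP}_{\infty,d}:H^{\omega_d}(\mathbb T^d)\to L_\infty(\mathbb T^d)$ (sup norm), $f\mapsto f$. $\Lambda^{\rm all}$: all continuous linear functionals; $\Lambda^{\rm std}$: point evaluations. $e(n,{\rm APP}_{\infty,d};\Lambda)$: infimum over algorithms $A(f)=\phi(L_1f,\dots,L_nf)$, $L_i\in\Lambda$, $\phi$ arbitrary, of $\sup_{\|f\|\le1}\|f-A(f)\|_\infty$; $e(0,{\rm APP}_{\infty,d})=\sup_{\|f\|\le1}\|f\|_\infty$. $n^\star(\varepsilon,d;\Lambda)=\inf\{n\ge0:e(n,{\rm APP}_{\infty,d};\Lambda)\le\varepsilon{\rm CRI}_d\}$ with ${\rm CRI}_d=1$ (ABS) or $e(0,{\rm APP}_{\infty,d})$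 (NOR). EXP-UWT for $\Lambda$: $\lim_{\varepsilon^{-1}+d\to\infty}\ln n^\star(\varepsilon,d;\Lambda)/((1+\ln\varepsilon^{-1})^\alpha+d^\beta)=0$ for all $\alpha,\beta>0$ ($d\in\mathbb N$, $\varepsilon\in(0,1)$). *)

theory Defs
  imports "HOL-Probability.Probability"
begin

text \<open>Points of the torus T^d are functions x :: nat => real (coordinates x 0, ..., x (d-1));
  frequencies k in Z^d are functions k :: nat => int vanishing outside {..<d}.\<close>

definition Zd :: "nat \<Rightarrow> (nat \<Rightarrow> int) set" where
  "Zd d = {k. \<forall>j\<ge>d. k j = 0}"

definition torus :: "nat \<Rightarrow> (nat \<Rightarrow> real) measure" where
  "torus d = PiM {..<d} (\<lambda>_. restrict_space lborel {0..1::real})"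

definition fhat :: "nat \<Rightarrow> ((nat \<Rightarrow> real) \<Rightarrow> complex) \<Rightarrow> (nat \<Rightarrow> int) \<Rightarrow> complex" where
  "fhat d f k = integral\<^sup>L (torus d)
     (\<lambda>x. f x * cis (- 2 * pi * (\<Sum>j<d. of_int (k j) * x j)))"

text \<open>The space H^{omega_d}(T^d): square integrable functions with
  sum |fhat k|^2 omega_d(k)^2 finite; each element is taken as its continuous representative,
  i.e. the (absolutely convergent) sum of its Fourier series, so that point evaluation is meaningful.\<close>
definition Hspace :: "(nat \<Rightarrow> (nat \<Rightarrow> int) \<Rightarrow> real) \<Rightarrow> nat \<Rightarrow> ((nat \<Rightarrow> real) \<Rightarrow> complex) set" where
  "Hspace \<omega> d = {f. f \<in> borel_measurable (torus d)
      \<and> integrable (torus d) (\<lambda>x. (cmod (f x))\<^sup>2)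
      \<and> (\<lambda>k. (cmod (fhat d f k))\<^sup>2 * (\<omega> d k)\<^sup>2) summable_on Zd d
      \<and> (\<forall>x\<in>space (torus d).
           ((\<lambda>k. fhat d f k * cis (2 * pi * (\<Sum>j<d. of_int (k j) * x j))) has_sum f x) (Zd d))}"

definition Hnorm :: "(nat \<Rightarrow> (nat \<Rightarrow> int) \<Rightarrow> real) \<Rightarrow> nat \<Rightarrow> ((nat \<Rightarrow> real) \<Rightarrow> complex) \<Rightarrow> real" where
  "Hnorm \<omega> d f = sqrt (\<Sum>\<^sub>\<infinity>k\<in>Zd d. (cmod (fhat d f k))\<^sup>2 * (\<omega> d k)\<^sup>2)"

definition Hball :: "(nat \<Rightarrow> (nat \<Rightarrow> int) \<Rightarrow> real) \<Rightarrow> nat \<Rightarrow> ((nat \<Rightarrow> real) \<Rightarrow> complex) set" where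
  "Hball \<omega> d = {f \<in> Hspace \<omega> d. Hnorm \<omega> d f \<le> 1}"

type_synonym functional = "((nat \<Rightarrow> real) \<Rightarrow> complex) \<Rightarrow> complex"

definition Lall :: "(nat \<Rightarrow> (nat \<Rightarrow> int) \<Rightarrow> real) \<Rightarrow> nat \<Rightarrow> functional set" where
  "Lall \<omega> d = {L. (\<forall>f\<in>Hspace \<omega> d. \<forall>g\<in>Hspace \<omega> d. L (\<lambda>x. f x + g x) = L f + L g)
      \<and> (\<forall>c. \<forall>f\<in>Hspace \<omega> d. L (\<lambda>x. c * f x) = c * L f)
      \<and> (\<exists>C. \<forall>f\<in>Hspace \<omega> d. cmod (L f) \<le> C * Hnorm \<omega> d f)}"

definition Lstd :: "nat \<Rightarrow> functional set" where
  "Lstd d = {L. \<exists>x\<in>space (torus d). L = (\<lambda>f. f x)}"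

text \<open>L_infinity (essential sup) distance on T^d; non-measurable functions get distance infinity.\<close>
definition linf_dist :: "nat \<Rightarrow> ((nat \<Rightarrow> real) \<Rightarrow> complex) \<Rightarrow> ((nat \<Rightarrow> real) \<Rightarrow> complex) \<Rightarrow> ereal" where
  "linf_dist d f g = esssup (torus d) (\<lambda>x. ereal (cmod (f x - g x)))"

definition init_err :: "(nat \<Rightarrow> (nat \<Rightarrow> int) \<Rightarrow> real) \<Rightarrow> nat \<Rightarrow> ereal" where
  "init_err \<omega> d = (SUP f\<in>Hball \<omega> d. linf_dist d f (\<lambda>_. 0))"

definition err :: "(nat \<Rightarrow> (nat \<Rightarrow> int) \<Rightarrow> real) \<Rightarrow> nat \<Rightarrow> functional set \<Rightarrow> nat \<Rightarrow> ereal" where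
  "err \<omega> d \<Lambda> n = (if n = 0 then init_err \<omega> d else
     (INF p\<in>{(L :: nat \<Rightarrow> functional, \<phi> :: complex list \<Rightarrow> (nat \<Rightarrow> real) \<Rightarrow> complex).
                 \<forall>i<n. L i \<in> \<Lambda>}.
        SUP f\<in>Hball \<omega> d. linf_dist d f ((snd p) (map (\<lambda>i. (fst p) i f) [0..<n]))))"

datatype crit = ABS | NOR

definition CRI :: "(nat \<Rightarrow> (nat \<Rightarrow> int) \<Rightarrow> real) \<Rightarrow> crit \<Rightarrow> nat \<Rightarrow> ereal" where
  "CRI \<omega> c d = (case c of ABS \<Rightarrow> 1 | NOR \<Rightarrow> init_err \<omega> d)"

text \<open>Information complexity; infinity if no n suffices.\<close>
definition nstar :: "(nat \<Rightarrow> (nat \<Rightarrow> int) \<Rightarrow> real) \<Rightarrow> crit \<Rightarrow> (nat \<Rightarrow> functional set) \<Rightarrow> real \<Rightarrow> nat \<Rightarrow> enat" where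
  "nstar \<omega> c \<Lambda> \<epsilon> d = Inf {enat n | n. err \<omega> d (\<Lambda> d) n \<le> ereal \<epsilon> * CRI \<omega> c d}"

text \<open>EXP-UWT: ln n*(eps,d) / ((1 + ln eps^{-1})^alpha + d^beta) -> 0 as eps^{-1} + d -> infinity
  (d >= 1, 0 < eps < 1), for all alpha, beta > 0. Convention: ln n* is read as ln (max 1 n*).\<close>
definition EXP_UWT :: "(nat \<Rightarrow> (nat \<Rightarrow> int) \<Rightarrow> real) \<Rightarrow> crit \<Rightarrow> (nat \<Rightarrow> functional set) \<Rightarrow> bool" where
  "EXP_UWT \<omega> c \<Lambda> \<longleftrightarrow>
    (\<forall>\<alpha>>0. \<forall>\<beta>>0. \<forall>\<delta>>0. \<exists>R. \<forall>d\<ge>1. \<forall>\<epsilon>. 0 < \<epsilon> \<and> \<epsilon> < 1 \<and> 1 / \<epsilon> + real d > R \<longrightarrow>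
       nstar \<omega> c \<Lambda> \<epsilon> d \<noteq> \<infinity> \<and>
       ln (max 1 (real (the_enat (nstar \<omega> c \<Lambda> \<epsilon> d))))
         / ((1 + ln (1 / \<epsilon>)) powr \<alpha> + real d powr \<beta>) \<le> \<delta>)"

end

theory Submission
  imports Defs "Jordan_Normal_Form.Determinant"
begin

text \<open>
  Let \<open>V n\<close> be the supremum of \<open>\<bar>det (f\<^sub>j (x\<^sub>i))\<bar>\<close> over all choices of \<open>n\<close> points \<open>x\<^sub>i\<close> of the
  torus and \<open>n\<close> functions \<open>f\<^sub>j\<close> of the unit ball, and put \<open>t = V (n + 1) / V n\<close>.
  Adding a point \<open>z\<close> and a function \<open>h\<close> vanishing at the points of an almost maximal \<open>n \<times> n\<close>
  configuration multiplies the determinant by \<open>h z\<close>; hence \<open>\<bar>h\<bar> \<le> 2 t\<close>, and sampling at these points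
  has error at most \<open>4 t\<close>. Conversely, the adjugate of an almost maximal configuration of size
  \<open>n + 1\<close> yields cardinal functions in the unit ball of height \<open>t / (2 (n + 1))\<close>, and some combination
  of them is annihilated by any \<open>n\<close> linear functionals, so that the error for arbitrary linear
  information is at least \<open>t / (2 (n + 1)\<^sup>2)\<close>. Sampling therefore loses at most the factor
  \<open>8 (n + 1)\<^sup>2\<close>. Since the exponents \<open>\<alpha> \<le> 1\<close> already express superpolynomial decay of the errors,
  this polynomial loss can be absorbed by shrinking \<open>\<epsilon>\<close>.
\<close>

section \<open>Determinants of evaluation matrices\<close>

definition eval_mat :: "nat \<Rightarrow> (nat \<Rightarrow> 'a) \<Rightarrow> (nat \<Rightarrow> 'a \<Rightarrow> complex) \<Rightarrow> complex mat" where
  "eval_mat n x f = mat n n (\<lambda>(i, j). f j (x i))"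

lemma eval_mat_carrier [simp]: "eval_mat n x f \<in> carrier_mat n n"
  by (simp add: eval_mat_def)

lemma dim_eval_mat [simp]: "dim_row (eval_mat n x f) = n" "dim_col (eval_mat n x f) = n"
  by (simp_all add: eval_mat_def)

lemma eval_mat_index [simp]: "i < n \<Longrightarrow> j < n \<Longrightarrow> eval_mat n x f $$ (i, j) = f j (x i)"
  by (simp add: eval_mat_def)

lemma mat_delete_eval_mat:
  "mat_delete (eval_mat (Suc n) x f) i j
    = eval_mat n (\<lambda>k. x (insert_index i k)) (\<lambda>k. f (insert_index j k))"
  by (rule eq_matI) (auto simp: mat_delete_def eval_mat_def insert_index_def)

text \<open>Deleting a row drops a point and deleting a column drops a function, so cofactors are
  again volumes of one size less. Every Laplace or adjugate estimate below rests on this.\<close>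

lemma cmod_cofactor_eval_mat:
  "cmod (cofactor (eval_mat (Suc n) x f) i j)
    = cmod (Determinant.det (eval_mat n (\<lambda>k. x (insert_index i k)) (\<lambda>k. f (insert_index j k))))"
  by (simp add: cofactor_def mat_delete_eval_mat norm_mult norm_power)

lemma insert_index_less: "k < n \<Longrightarrow> insert_index i k < Suc n"
  by (simp add: insert_index_def)

text \<open>Abstracts the unit ball of a space of bounded functions. Absolute convexity enters only
  through equally weighted averages; general coefficients of modulus at most 1 allow signs and
  normalised cofactors.\<close>

locale bounded_function_class =
  fixes X :: "'a set" and B :: "('a \<Rightarrow> complex) set" and C :: real
  assumes points_nonempty: "X \<noteq> {}"
    and zero_mem: "(\<lambda>_. 0) \<in> B"
    and bounded: "\<And>f x. f \<in> B \<Longrightarrow> x \<in> X \<Longrightarrow> cmod (f x) \<le> C"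
    and average_mem: "\<And>(n::nat) c f. n > 0 \<Longrightarrow> (\<And>i. i < n \<Longrightarrow> cmod (c i) \<le> 1) \<Longrightarrow>
      (\<And>i. i < n \<Longrightarrow> f i \<in> B) \<Longrightarrow> (\<lambda>x. (\<Sum>i<n. c i * f i x) / of_nat n) \<in> B"
begin

definition volumes :: "nat \<Rightarrow> real set" where
  "volumes n = {cmod (Determinant.det (eval_mat n x f)) | x f.
     (\<forall>i<n. x i \<in> X) \<and> (\<forall>j<n. f j \<in> B)}"

definition max_volume :: "nat \<Rightarrow> real" where
  "max_volume n = Sup (volumes n)"

lemma volumes_nonempty: "volumes n \<noteq> {}"
proof -
  obtain p where "p \<in> X" using points_nonempty by blast
  then have "cmod (Determinant.det (eval_mat n (\<lambda>_. p) (\<lambda>_ _. 0))) \<in> volumes n"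
    unfolding volumes_def using zero_mem by (intro CollectI exI conjI) auto
  then show ?thesis by blast
qed

text \<open>Induction by expansion along the first row: the entries are at most \<open>C\<close> and
  the cofactors are volumes of the previous size. This makes the supremum in
  \<open>max_volume\<close> meaningful.\<close>

lemma volumes_bdd_above: "bdd_above (volumes n)"
proof (induction n)
  case 0
  show ?case by (auto simp: volumes_def)
next
  case (Suc n)
  then obtain K where K: "\<And>v. v \<in> volumes n \<Longrightarrow> v \<le> K"
    by (auto simp: bdd_above_def)
  show ?case
  proof (rule bdd_aboveI)
    fix v assume "v \<in> volumes (Suc n)"
    then obtain x f where v: "v = cmod (Determinant.det (eval_mat (Suc n) x f))"
      and x: "\<forall>i<Suc n. x i \<in> X" and f: "\<forall>j<Suc n. f j \<in> B"
      unfolding volumes_def by blast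
    have cof: "cmod (cofactor (eval_mat (Suc n) x f) 0 j) \<le> K" for j
      unfolding cmod_cofactor_eval_mat
      by (rule K) (use x f in \<open>auto simp: volumes_def intro!: exI insert_index_less\<close>)
    have "v \<le> (\<Sum>j<Suc n. cmod (f j (x 0) * cofactor (eval_mat (Suc n) x f) 0 j))"
      unfolding v by (subst laplace_expansion_row[where n = "Suc n" and i = 0])
        (auto intro!: order.trans[OF norm_sum] simp del: sum.lessThan_Suc)
    also have "\<dots> \<le> (\<Sum>j<Suc n. C * K)"
      unfolding norm_mult
      by (intro sum_mono mult_mono cof bounded) (use x f bounded[of "f 0" "x 0"] in \<open>auto intro: order.trans[OF norm_ge_zero]\<close>)
    finally show "v \<le> (\<Sum>j<Suc n. C * K)" .
  qed
qed

lemma det_le_max_volume: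
  assumes "\<And>i. i < n \<Longrightarrow> x i \<in> X" "\<And>j. j < n \<Longrightarrow> f j \<in> B"
  shows "cmod (Determinant.det (eval_mat n x f)) \<le> max_volume n"
  unfolding max_volume_def
  by (rule cSup_upper[OF _ volumes_bdd_above]) (use assms in \<open>auto simp: volumes_def\<close>)

lemma max_volume_nonneg: "max_volume n \<ge> 0"
proof -
  obtain v where v: "v \<in> volumes n" using volumes_nonempty by blast
  then have "0 \<le> v" by (auto simp: volumes_def)
  also have "v \<le> max_volume n"
    unfolding max_volume_def by (rule cSup_upper[OF v volumes_bdd_above])
  finally show ?thesis .
qed

lemma max_volume_0: "max_volume 0 = 1"
proof -
  have "volumes 0 = {1}" by (auto simp: volumes_def eval_mat_def)
  then show ?thesis by (simp add: max_volume_def)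
qed

text \<open>Without compactness the supremum need not be attained. Settling for more than half of it
  causes the factor 2 in \<open>sampling_points\<close> and in the height of the cardinal
  functions.\<close>

lemma near_maximal_volume:
  assumes "max_volume n > 0"
  shows "\<exists>x f. (\<forall>i<n. x i \<in> X) \<and> (\<forall>j<n. f j \<in> B) \<and>
    cmod (Determinant.det (eval_mat n x f)) > max_volume n / 2"
proof -
  have "max_volume n / 2 < Sup (volumes n)" using assms by (simp add: max_volume_def)
  then obtain v where "v \<in> volumes n" "max_volume n / 2 < v"
    using volumes_nonempty less_cSupE by blast
  then show ?thesis unfolding volumes_def by blast
qed

text \<open>Meant for half differences of two members of \<open>B\<close> with equal samples: they
  vanish at the points and lie in \<open>B\<close> by \<open>average_mem\<close>.\<close>

lemma sampling_points:
  assumes "max_volume n > 0"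
  shows "\<exists>x. (\<forall>i<n. x i \<in> X) \<and> (\<forall>h\<in>B. (\<forall>i<n. h (x i) = 0) \<longrightarrow>
    (\<forall>z\<in>X. cmod (h z) \<le> 2 * (max_volume (Suc n) / max_volume n)))"
proof -
  obtain x f where x: "\<And>i. i < n \<Longrightarrow> x i \<in> X" and f: "\<And>j. j < n \<Longrightarrow> f j \<in> B"
    and big: "cmod (Determinant.det (eval_mat n x f)) > max_volume n / 2"
    using near_maximal_volume[OF assms] by blast
  have "cmod (h z) \<le> 2 * (max_volume (Suc n) / max_volume n)"
    if h: "h \<in> B" and van: "\<And>i. i < n \<Longrightarrow> h (x i) = 0" and z: "z \<in> X" for h z
  proof -
    define M where "M = eval_mat (Suc n) (x(n := z)) (f(n := h))"
    have minor: "eval_mat n (\<lambda>k. (x(n := z)) (insert_index n k)) (\<lambda>k. (f(n := h)) (insert_index n k))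
        = eval_mat n x f"
      by (rule eq_matI) (auto simp: eval_mat_def insert_index_def)
    have "Determinant.det M = (\<Sum>i<Suc n. M $$ (i, n) * cofactor M i n)"
      by (rule laplace_expansion_column) (auto simp: M_def)
    \<comment> \<open>The last column holds the values of \<open>h\<close>, which vanish at all
      points but the added one; the cofactor there is the old determinant.\<close>
    also have "\<dots> = h z * cofactor M n n"
      by (simp add: M_def van)
    finally have "cmod (Determinant.det M) = cmod (h z) * cmod (cofactor M n n)"
      by (simp add: norm_mult)
    also have "cmod (cofactor M n n) = cmod (Determinant.det (eval_mat n x f))"
      unfolding M_def cmod_cofactor_eval_mat minor ..
    finally have "cmod (Determinant.det M) = cmod (h z) * cmod (Determinant.det (eval_mat n x f))" .
    moreover have "cmod (Determinant.det M) \<le> max_volume (Suc n)"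
      unfolding M_def by (rule det_le_max_volume) (use x f h z in \<open>auto simp: less_Suc_eq\<close>)
    moreover have "cmod (h z) * (max_volume n / 2) \<le> cmod (h z) * cmod (Determinant.det (eval_mat n x f))"
      using big by (intro mult_left_mono) auto
    ultimately have "cmod (h z) * (max_volume n / 2) \<le> max_volume (Suc n)" by linarith
    then show ?thesis using assms by (simp add: field_simps)
  qed
  then show ?thesis using x by blast
qed

lemma cardinal_functions:
  assumes pos: "max_volume n > 0" and pos': "max_volume (Suc n) > 0"
  defines "t \<equiv> max_volume (Suc n) / max_volume n"
  shows "\<exists>y g. (\<forall>i\<le>n. y i \<in> X \<and> g i \<in> B) \<and> (\<forall>i\<le>n. \<forall>j\<le>n.
    g i (y j) = (if i = j then of_real (t / (2 * (real n + 1))) else 0))"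
proof -
  obtain y f where y: "\<And>i. i < Suc n \<Longrightarrow> y i \<in> X" and f: "\<And>j. j < Suc n \<Longrightarrow> f j \<in> B"
    and big: "cmod (Determinant.det (eval_mat (Suc n) y f)) > max_volume (Suc n) / 2"
    using near_maximal_volume[OF pos'] by blast
  define M where "M = eval_mat (Suc n) y f"
  have M: "M \<in> carrier_mat (Suc n) (Suc n)" by (simp add: M_def)
  define D where "D = Determinant.det M"
  have D: "cmod D > max_volume (Suc n) / 2" "D \<noteq> 0"
    using big pos' by (auto simp: D_def M_def)
  \<comment> \<open>Both factors have modulus at most 1: a cofactor is a volume of size
    \<open>n\<close>, and \<open>D\<close> exceeds half of the maximal volume of size
    \<open>n + 1\<close>.\<close>
  define c where "c i j = cofactor M i j / of_real (max_volume n) * (of_real (max_volume (Suc n)) / (2 * D))" for i j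
  define g where "g i = (\<lambda>x. (\<Sum>j<Suc n. c i j * f j x) / of_nat (Suc n))" for i
  have c1: "cmod (c i j) \<le> 1" if "i < Suc n" "j < Suc n" for i j
  proof -
    have "cmod (cofactor M i j) \<le> max_volume n"
      unfolding M_def cmod_cofactor_eval_mat
      by (rule det_le_max_volume) (use y f in \<open>auto intro: insert_index_less\<close>)
    then have 1: "cmod (cofactor M i j / of_real (max_volume n)) \<le> 1"
      using pos by (simp add: norm_divide)
    have 2: "cmod (of_real (max_volume (Suc n)) / (2 * D)) \<le> 1"
      using D pos' by (simp add: norm_divide norm_mult divide_le_eq)
    show ?thesis unfolding c_def norm_mult using mult_mono[OF 1 2] by simp
  qed
  have gB: "g i \<in> B" if "i < Suc n" for i
    unfolding g_def by (rule average_mem) (use c1 f that in auto)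
  have gy: "g i (y l) = (if i = l then of_real (t / (2 * (real n + 1))) else 0)"
    if i: "i < Suc n" and l: "l < Suc n" for i l
  proof -
    \<comment> \<open>The product of a matrix with its adjugate is the determinant times the
      identity. After scaling, the diagonal value \<open>D\<close> becomes \<open>t / 2\<close>, and
      the average divides it by \<open>n + 1\<close>.\<close>
    have "(\<Sum>j<Suc n. f j (y l) * cofactor M i j) = (M * adj_mat M) $$ (l, i)"
      unfolding times_mat_def scalar_prod_def adj_mat_def using i l M
      by (auto simp: M_def atLeast0LessThan intro!: sum.cong simp del: sum.lessThan_Suc)
    also have "\<dots> = (if i = l then D else 0)"
      using adj_mat(2)[OF M] i l by (auto simp: D_def)
    finally have S: "(\<Sum>j<Suc n. f j (y l) * cofactor M i j) = (if i = l then D else 0)" .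
    have "(\<Sum>j<Suc n. c i j * f j (y l)) =
      (\<Sum>j<Suc n. f j (y l) * cofactor M i j) * (of_real (max_volume (Suc n)) / (of_real (max_volume n) * (2 * D)))"
      unfolding sum_distrib_right by (intro sum.cong) (auto simp: c_def field_simps)
    also have "\<dots> = (if i = l then of_real (t / 2) else 0)"
      unfolding S using D pos by (auto simp: t_def field_simps)
    finally show ?thesis unfolding g_def by (auto simp: field_simps)
  qed
  show ?thesis
    by (intro exI[of _ y] exI[of _ g]) (use y gB gy in \<open>auto simp: less_Suc_eq_le\<close>)
qed

text \<open>One number \<open>t\<close> serves both as the upper bound for sampling and as the
  height of the cardinal functions, so it cancels when the two errors are compared.\<close>

theorem sampling_points_and_cardinal_functions:
  "\<exists>t\<ge>0. (\<exists>x. (\<forall>i<n. x i \<in> X) \<and>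
        (\<forall>h\<in>B. (\<forall>i<n. h (x i) = 0) \<longrightarrow> (\<forall>z\<in>X. cmod (h z) \<le> 2 * t))) \<and>
      (\<exists>y g. (\<forall>i\<le>n. y i \<in> X \<and> g i \<in> B) \<and> (\<forall>i\<le>n. \<forall>j\<le>n.
        g i (y j) = (if i = j then of_real (t / (2 * (real n + 1))) else 0)))"
proof (cases "max_volume n > 0 \<and> max_volume (Suc n) > 0")
  case True
  then show ?thesis
    using sampling_points[of n] cardinal_functions[of n]
    by (intro exI[of _ "max_volume (Suc n) / max_volume n"]) auto
next
  case False
  then have ex: "\<exists>k\<le>Suc n. max_volume k = 0"
    using max_volume_nonneg by (metis le_SucI less_le order_refl)
  \<comment> \<open>In the degenerate case \<open>t = 0\<close> works. The first vanishing volume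
    has positive size because the empty determinant is 1; just below it the quotient of volumes is
    0, so zeros at \<open>m\<close> points force \<open>h\<close> to vanish.\<close>
  define k where "k = (LEAST k. max_volume k = 0)"
  have k0: "max_volume k = 0" and kle: "k \<le> Suc n"
    using ex LeastI[of "\<lambda>k. max_volume k = 0"] Least_le[of "\<lambda>k. max_volume k = 0"]
    unfolding k_def by (blast, meson order_trans)
  then obtain m where m: "k = Suc m" using max_volume_0 by (cases k) auto
  have "max_volume m \<noteq> 0" using not_less_Least[of m "\<lambda>k. max_volume k = 0"] m by (auto simp: k_def)
  then have "max_volume m > 0" using max_volume_nonneg[of m] by simp
  from sampling_points[OF this] obtain x where x: "\<And>i. i < m \<Longrightarrow> x i \<in> X"
    and van: "\<And>h z. h \<in> B \<Longrightarrow> (\<forall>i<m. h (x i) = 0) \<Longrightarrow> z \<in> X \<Longrightarrow> h z = 0"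
    using k0 m by fastforce
  obtain p where p: "p \<in> X" using points_nonempty by blast
  \<comment> \<open>The \<open>m\<close> points are padded to \<open>n\<close> by an arbitrary
    point, which only adds conditions on \<open>h\<close>.\<close>
  define x' where "x' i = (if i < m then x i else p)" for i
  have "m \<le> n" using kle m by simp
  have "h z = 0" if h: "h \<in> B" and hx: "\<forall>i<n. h (x' i) = 0" and z: "z \<in> X" for h z
  proof (rule van[OF h _ z], intro allI impI)
    fix i assume "i < m"
    then show "h (x i) = 0" using hx[rule_format, of i] \<open>m \<le> n\<close> by (simp add: x'_def)
  qed
  moreover have "\<forall>i<n. x' i \<in> X" using x p by (simp add: x'_def)
  ultimately have 1: "\<exists>x. (\<forall>i<n. x i \<in> X) \<and>
      (\<forall>h\<in>B. (\<forall>i<n. h (x i) = 0) \<longrightarrow> (\<forall>z\<in>X. cmod (h z) \<le> 2 * 0))"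
    by (intro exI[of _ x']) simp
  have 2: "\<exists>y g. (\<forall>i\<le>n. y i \<in> X \<and> g i \<in> B) \<and> (\<forall>i\<le>n. \<forall>j\<le>n.
        g i (y j) = (if i = j then of_real (0 / (2 * (real n + 1))) else 0))"
    using p zero_mem by (intro exI[of _ "\<lambda>_. p"] exI[of _ "\<lambda>_ _. 0"]) auto
  show ?thesis by (rule exI[of _ "0::real"], intro conjI order_refl 1 2)
qed

end

text \<open>A nonzero solution exists because there are more unknowns than equations. Normalising in
  the maximum norm makes the coefficients fit \<open>average_mem\<close>, while the one of modulus 1
  keeps a point value large.\<close>

lemma underdetermined_homogeneous_system:
  fixes a :: "nat \<Rightarrow> nat \<Rightarrow> complex"
  shows "\<exists>c. (\<forall>i<n. (\<Sum>j\<le>n. c j * a i j) = 0) \<and> (\<forall>j\<le>n. cmod (c j) \<le> 1) \<and> (\<exists>j\<le>n. cmod (c j) = 1)"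
proof -
  \<comment> \<open>A zero row makes the system square, with vanishing determinant.\<close>
  define A where "A = mat (Suc n) (Suc n) (\<lambda>(i, j). if i < n then a i j else 0)"
  have A: "A \<in> carrier_mat (Suc n) (Suc n)" by (simp add: A_def)
  have "Determinant.det A = (\<Sum>j<Suc n. A $$ (n, j) * cofactor A n j)"
    by (rule laplace_expansion_row[OF A]) simp
  also have "\<dots> = 0" by (intro sum.neutral) (auto simp: A_def)
  finally obtain v where v: "v \<in> carrier_vec (Suc n)" "v \<noteq> 0\<^sub>v (Suc n)" "A *\<^sub>v v = 0\<^sub>v (Suc n)"
    using det_0_iff_vec_prod_zero[OF A] by blast
  define w where "w j = vec_index v j" for j
  have sol: "(\<Sum>j\<le>n. w j * a i j) = 0" if "i < n" for i
  proof -
    have "vec_index (A *\<^sub>v v) i = 0" using v(3) that by simp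
    then have "(\<Sum>j<Suc n. a i j * w j) = 0"
      using that v(1) by (auto simp: A_def scalar_prod_def w_def atLeast0LessThan simp del: sum.lessThan_Suc)
    then show ?thesis by (simp add: lessThan_Suc_atMost mult.commute)
  qed
  have "\<exists>j\<le>n. w j \<noteq> 0"
  proof (rule ccontr)
    assume "\<not> ?thesis"
    then have "v = 0\<^sub>v (Suc n)" using v(1) by (intro eq_vecI) (auto simp: w_def)
    with v(2) show False ..
  qed
  moreover define m where "m = Max ((\<lambda>j. cmod (w j)) ` {..n})"
  have le: "cmod (w j) \<le> m" if "j \<le> n" for j unfolding m_def using that by (intro Max_ge) auto
  have "m \<in> (\<lambda>j. cmod (w j)) ` {..n}" unfolding m_def by (intro Max_in) auto
  then obtain k where k: "k \<le> n" "cmod (w k) = m" by auto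
  ultimately have mpos: "m > 0" using le by (metis norm_le_zero_iff not_le order_trans)
  have "(\<Sum>j\<le>n. (w j / of_real m) * a i j) = 0" if "i < n" for i
  proof -
    have "(\<Sum>j\<le>n. (w j / of_real m) * a i j) = (\<Sum>j\<le>n. w j * a i j) / of_real m"
      unfolding sum_divide_distrib by (intro sum.cong) auto
    then show ?thesis using sol[OF that] by simp
  qed
  then show ?thesis using mpos le k
    by (intro exI[of _ "\<lambda>j. w j / of_real m"]) (auto simp: norm_divide)
qed

section \<open>The weighted space on the torus\<close>

lemma has_sum_finite_sum:
  fixes f :: "'i \<Rightarrow> 'a \<Rightarrow> 'b::topological_comm_monoid_add"
  assumes "\<And>i. i \<in> I \<Longrightarrow> (f i has_sum s i) A"
  shows "((\<lambda>x. \<Sum>i\<in>I. f i x) has_sum (\<Sum>i\<in>I. s i)) A"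
  using assms by (induction I rule: infinite_finite_induct) (auto intro: has_sum_add)

lemma cmod_sum_squared_le:
  fixes z :: "nat \<Rightarrow> complex"
  shows "(cmod (\<Sum>i<n. z i))\<^sup>2 \<le> real n * (\<Sum>i<n. (cmod (z i))\<^sup>2)"
proof -
  have "(cmod (\<Sum>i<n. z i))\<^sup>2 \<le> (\<Sum>i<n. cmod (z i))\<^sup>2"
    by (intro power_mono norm_sum) simp
  also have "\<dots> \<le> (\<Sum>i<n. (cmod (z i))\<^sup>2) * card {..<n}"
    by (rule sum_squared_le_sum_of_squares)
  finally show ?thesis by (simp add: mult.commute)
qed

section \<open>The torus as a probability space\<close>

abbreviation unit_interval :: "real measure" where
  "unit_interval \<equiv> restrict_space lborel {0..1}"

abbreviation wave :: "nat \<Rightarrow> (nat \<Rightarrow> int) \<Rightarrow> (nat \<Rightarrow> real) \<Rightarrow> complex" where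
  "wave d k x \<equiv> cis (2 * pi * (\<Sum>j<d. of_int (k j) * x j))"

lemma prob_space_unit_interval: "prob_space unit_interval"
  by (rule prob_spaceI) (simp add: emeasure_restrict_space)

lemma prob_space_torus: "prob_space (torus d)"
  unfolding torus_def by (rule prob_space_PiM) (rule prob_space_unit_interval)

lemma space_torus: "space (torus d) = PiE {..<d} (\<lambda>_. {0..1})"
  by (simp add: torus_def space_PiM space_restrict_space)

lemma space_torus_nonempty: "space (torus d) \<noteq> {}"
  by (simp add: prob_space.not_empty prob_space_torus)

lemma measurable_torus_component [measurable]:
  "j < d \<Longrightarrow> (\<lambda>x. x j) \<in> borel_measurable (torus d)"
proof -
  assume "j < d"
  then have "(\<lambda>x. x j) \<in> torus d \<rightarrow>\<^sub>M unit_interval"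
    unfolding torus_def by (intro measurable_component_singleton) simp
  moreover have "(\<lambda>y. y) \<in> borel_measurable unit_interval"
    by (rule measurable_restrict_space1) simp
  ultimately show ?thesis by (rule measurable_compose)
qed

lemma measurable_phase:
  "(\<lambda>x. cis (a * (\<Sum>j<d. of_int (k j) * x j))) \<in> borel_measurable (torus d)"
proof -
  have [measurable]: "cis \<in> borel_measurable borel"
    by (intro borel_measurable_continuous_onI continuous_intros)
  have "(\<lambda>x. \<Sum>j<d. of_int (k j) * x j :: real) \<in> borel_measurable (torus d)"
    by (intro borel_measurable_sum borel_measurable_times measurable_torus_component) auto
  then show ?thesis by measurable
qed

text \<open>Lets an almost everywhere bound be tested arbitrarily close to any given point.\<close>

lemma emeasure_torus_box_pos:
  assumes x: "x \<in> space (torus d)" and r: "r > 0"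
  shows "emeasure (torus d) (PiE {..<d} (\<lambda>j. {0..1} \<inter> {x j - r<..<x j + r})) > 0"
proof -
  interpret product_sigma_finite "\<lambda>_::nat. unit_interval"
    by (intro product_sigma_finite.intro prob_space_imp_sigma_finite prob_space_unit_interval)
  have mem: "{0..1} \<inter> {a<..<b} \<in> sets unit_interval" for a b :: real
    by (auto simp: sets_restrict_space)
  have pos: "emeasure unit_interval ({0..1} \<inter> {x j - r<..<x j + r}) > 0" if "j < d" for j
  proof -
    have xj: "0 \<le> x j" "x j \<le> 1" using x that by (auto simp: space_torus PiE_iff)
    \<comment> \<open>Clipping at 0 and 1 leaves a nondegenerate interval even if \<open>x j\<close>
      is an endpoint.\<close>
    define a b where "a = max 0 (x j - r)" and "b = min 1 (x j + r)"
    have ab: "a < b" using xj r by (auto simp: a_def b_def)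
    then have "0 < emeasure lborel {a<..<b}" by simp
    also have "\<dots> \<le> emeasure lborel ({0..1} \<inter> {x j - r<..<x j + r})"
      by (intro emeasure_mono) (auto simp: a_def b_def)
    also have "\<dots> = emeasure unit_interval ({0..1} \<inter> {x j - r<..<x j + r})"
      by (subst emeasure_restrict_space) auto
    finally show ?thesis .
  qed
  have "emeasure (torus d) (PiE {..<d} (\<lambda>j. {0..1} \<inter> {x j - r<..<x j + r}))
      = (\<Prod>j<d. emeasure unit_interval ({0..1} \<inter> {x j - r<..<x j + r}))"
    unfolding torus_def by (rule emeasure_PiM) (use mem in auto)
  moreover have "\<dots> \<noteq> 0" using pos by (force simp: prod_zero_iff)
  ultimately show ?thesis by (simp add: zero_less_iff_neq_zero)
qed

section \<open>Linear structure of the space and convexity of its unit ball\<close>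

lemma Hspace_integrable:
  assumes "f \<in> Hspace \<omega> d"
  shows "integrable (torus d) f"
proof -
  interpret prob_space "torus d" by (rule prob_space_torus)
  have f: "f \<in> borel_measurable (torus d)" "integrable (torus d) (\<lambda>x. (cmod (f x))\<^sup>2)"
    using assms by (simp_all add: Hspace_def)
  have "integrable (torus d) (\<lambda>x. cmod (f x))"
    by (rule square_integrable_imp_integrable[OF measurable_compose[OF f(1) borel_measurable_norm] f(2)])
  then show ?thesis using f(1) by (rule integrable_norm_cancel)
qed

lemma fhat_linear_combination:
  fixes n :: nat
  assumes "\<And>i. i < n \<Longrightarrow> f i \<in> Hspace \<omega> d"
  shows "fhat d (\<lambda>x. \<Sum>i<n. c i * f i x) k = (\<Sum>i<n. c i * fhat d (f i) k)"
proof -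
  let ?e = "\<lambda>x. cis (- 2 * pi * (\<Sum>j<d. of_int (k j) * x j))"
  have int: "integrable (torus d) (\<lambda>x. f i x * ?e x)" if "i < n" for i
  proof (rule Bochner_Integration.integrable_bound)
    show "integrable (torus d) (f i)" using assms[OF that] by (rule Hspace_integrable)
    show "(\<lambda>x. f i x * ?e x) \<in> borel_measurable (torus d)"
      using assms[OF that] by (intro borel_measurable_times measurable_phase) (simp add: Hspace_def)
  qed (simp add: norm_mult)
  have "fhat d (\<lambda>x. \<Sum>i<n. c i * f i x) k = integral\<^sup>L (torus d) (\<lambda>x. \<Sum>i<n. c i * (f i x * ?e x))"
    unfolding fhat_def by (simp add: sum_distrib_right mult.assoc)
  also have "\<dots> = (\<Sum>i<n. integral\<^sup>L (torus d) (\<lambda>x. c i * (f i x * ?e x)))"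
    using int by (intro Bochner_Integration.integral_sum) auto
  also have "\<dots> = (\<Sum>i<n. c i * fhat d (f i) k)"
    unfolding fhat_def by (intro sum.cong) auto
  finally show ?thesis .
qed

text \<open>Squares of sums are dominated by sums of squares, which gives both integrability and
  weighted summability. Arbitrary length also covers the zero function and scalar multiples.\<close>

lemma Hspace_linear_combination:
  fixes n :: nat
  assumes f: "\<And>i. i < n \<Longrightarrow> f i \<in> Hspace \<omega> d"
  shows "(\<lambda>x. \<Sum>i<n. c i * f i x) \<in> Hspace \<omega> d"
proof -
  let ?g = "\<lambda>x. \<Sum>i<n. c i * f i x"
  have meas: "?g \<in> borel_measurable (torus d)"
    using f by (intro borel_measurable_sum borel_measurable_times) (auto simp: Hspace_def)
  have sq: "(cmod (\<Sum>i<n. c i * z i))\<^sup>2 \<le> real n * (\<Sum>i<n. (cmod (c i))\<^sup>2 * (cmod (z i))\<^sup>2)" for z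
    using cmod_sum_squared_le[where z = "\<lambda>i. c i * z i" and n = n] by (simp add: norm_mult power_mult_distrib)
  have int: "integrable (torus d) (\<lambda>x. (cmod (?g x))\<^sup>2)"
  proof (rule Bochner_Integration.integrable_bound)
    show "integrable (torus d) (\<lambda>x. real n * (\<Sum>i<n. (cmod (c i))\<^sup>2 * (cmod (f i x))\<^sup>2))"
      using f by (intro Bochner_Integration.integrable_mult_right Bochner_Integration.integrable_sum) (auto simp: Hspace_def)
    show "(\<lambda>x. (cmod (?g x))\<^sup>2) \<in> borel_measurable (torus d)"
      using meas by measurable
    show "AE x in torus d. norm ((cmod (?g x))\<^sup>2) \<le> norm (real n * (\<Sum>i<n. (cmod (c i))\<^sup>2 * (cmod (f i x))\<^sup>2))"
      by (intro AE_I2) (use order.trans[OF sq abs_ge_self] in simp)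
  qed
  have "(\<lambda>k. (cmod (fhat d ?g k))\<^sup>2 * (\<omega> d k)\<^sup>2) summable_on Zd d"
  proof (rule summable_on_comparison_test)
    have "(\<lambda>k. \<Sum>i<n. (cmod (c i))\<^sup>2 * ((cmod (fhat d (f i) k))\<^sup>2 * (\<omega> d k)\<^sup>2)) summable_on Zd d"
      by (rule has_sum_imp_summable, rule has_sum_finite_sum, rule has_sum_cmult_right, rule has_sum_infsum)
        (use f in \<open>simp add: Hspace_def\<close>)
    then show "(\<lambda>k. real n * (\<Sum>i<n. (cmod (c i))\<^sup>2 * ((cmod (fhat d (f i) k))\<^sup>2 * (\<omega> d k)\<^sup>2))) summable_on Zd d"
      by (rule summable_on_cmult_right)
    show "(cmod (fhat d ?g k))\<^sup>2 * (\<omega> d k)\<^sup>2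
        \<le> real n * (\<Sum>i<n. (cmod (c i))\<^sup>2 * ((cmod (fhat d (f i) k))\<^sup>2 * (\<omega> d k)\<^sup>2))" for k
      using mult_right_mono[OF sq[of "\<lambda>i. fhat d (f i) k"], of "(\<omega> d k)\<^sup>2"]
      by (simp add: fhat_linear_combination[OF f] sum_distrib_right mult.assoc)
  qed simp
  moreover have "((\<lambda>k. fhat d ?g k * wave d k x) has_sum ?g x) (Zd d)" if "x \<in> space (torus d)" for x
  proof -
    have "((\<lambda>k. \<Sum>i<n. c i * (fhat d (f i) k * wave d k x)) has_sum ?g x) (Zd d)"
      by (intro has_sum_finite_sum has_sum_cmult_right) (use f that in \<open>auto simp: Hspace_def\<close>)
    then show ?thesis by (simp add: fhat_linear_combination[OF f] sum_distrib_right mult.assoc)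
  qed
  ultimately show ?thesis using meas int by (simp add: Hspace_def)
qed

lemma Hspace_scale: "f \<in> Hspace \<omega> d \<Longrightarrow> (\<lambda>x. a * f x) \<in> Hspace \<omega> d"
  using Hspace_linear_combination[where n = 1 and f = "\<lambda>_. f" and c = "\<lambda>_. a"] by simp

lemma Lall_linear_combination:
  fixes n :: nat
  assumes L: "L \<in> Lall \<omega> d" and f: "\<And>i. i < n \<Longrightarrow> f i \<in> Hspace \<omega> d"
  shows "L (\<lambda>x. \<Sum>i<n. c i * f i x) = (\<Sum>i<n. c i * L (f i))"
  using f
proof (induction n)
  case 0
  \<comment> \<open>For the empty sum, \<open>L\<close> vanishes at the zero function by homogeneity
    with the scalar 0.\<close>
  have "(\<lambda>_. 0) \<in> Hspace \<omega> d"
    using Hspace_linear_combination[of 0 "\<lambda>_ _. 0"] by simp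
  moreover have "L (\<lambda>x. a * g x) = a * L g" if "g \<in> Hspace \<omega> d" for a g
    using L that by (simp add: Lall_def)
  ultimately have "L (\<lambda>x. 0 * (\<lambda>_. 0) x) = 0 * L (\<lambda>_. 0)" by blast
  then show ?case by simp
next
  case (Suc n)
  have "L (\<lambda>x. (\<Sum>i<n. c i * f i x) + c n * f n x) = L (\<lambda>x. \<Sum>i<n. c i * f i x) + L (\<lambda>x. c n * f n x)"
    using L Suc.prems Hspace_linear_combination[of n f \<omega> d c] Hspace_scale[of "f n" \<omega> d "c n"]
    unfolding Lall_def by auto
  moreover have "L (\<lambda>x. c n * f n x) = c n * L (f n)"
    using L Suc.prems unfolding Lall_def by auto
  ultimately show ?case using Suc by simp
qed

lemma Hball_iff: "f \<in> Hball \<omega> d \<longleftrightarrow>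
    f \<in> Hspace \<omega> d \<and> (\<Sum>\<^sub>\<infinity>k\<in>Zd d. (cmod (fhat d f k))\<^sup>2 * (\<omega> d k)\<^sup>2) \<le> 1"
  by (simp add: Hball_def Hnorm_def)

text \<open>Convexity of the square, applied to each Fourier coefficient, bounds the squared norm of
  the average by the average of the squared norms; no triangle inequality for \<open>Hnorm\<close>
  has to be proved.\<close>

lemma Hball_average:
  fixes n :: nat
  assumes n: "n > 0" and c: "\<And>i. i < n \<Longrightarrow> cmod (c i) \<le> 1" and f: "\<And>i. i < n \<Longrightarrow> f i \<in> Hball \<omega> d"
  shows "(\<lambda>x. (\<Sum>i<n. c i * f i x) / of_nat n) \<in> Hball \<omega> d"
proof -
  define b where "b i = c i / of_nat n" for i
  let ?g = "\<lambda>x. \<Sum>i<n. b i * f i x"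
  have fH: "\<And>i. i < n \<Longrightarrow> f i \<in> Hspace \<omega> d" using f by (simp add: Hball_def)
  have g: "(\<lambda>x. (\<Sum>i<n. c i * f i x) / of_nat n) = ?g"
    by (simp add: b_def sum_divide_distrib)
  have gH: "?g \<in> Hspace \<omega> d" using fH by (rule Hspace_linear_combination)
  define s where "s i = (\<Sum>\<^sub>\<infinity>k\<in>Zd d. (cmod (fhat d (f i) k))\<^sup>2 * (\<omega> d k)\<^sup>2)" for i
  have s: "((\<lambda>k. (cmod (fhat d (f i) k))\<^sup>2 * (\<omega> d k)\<^sup>2) has_sum s i) (Zd d)" if "i < n" for i
    unfolding s_def using fH[OF that] by (intro has_sum_infsum) (simp add: Hspace_def)
  have s1: "s i \<le> 1" if "i < n" for i using f[OF that] by (simp add: Hball_iff s_def)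
  have up: "((\<lambda>k. \<Sum>i<n. (1 / real n) * ((cmod (fhat d (f i) k))\<^sup>2 * (\<omega> d k)\<^sup>2))
      has_sum (\<Sum>i<n. (1 / real n) * s i)) (Zd d)"
    using s by (intro has_sum_finite_sum has_sum_cmult_right) auto
  have lo: "((\<lambda>k. (cmod (fhat d ?g k))\<^sup>2 * (\<omega> d k)\<^sup>2) has_sum
      (\<Sum>\<^sub>\<infinity>k\<in>Zd d. (cmod (fhat d ?g k))\<^sup>2 * (\<omega> d k)\<^sup>2)) (Zd d)"
    using gH by (intro has_sum_infsum) (simp add: Hspace_def)
  have "(cmod (fhat d ?g k))\<^sup>2 * (\<omega> d k)\<^sup>2
      \<le> (\<Sum>i<n. (1 / real n) * ((cmod (fhat d (f i) k))\<^sup>2 * (\<omega> d k)\<^sup>2))" for k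
  proof -
    have "(cmod (fhat d ?g k))\<^sup>2 \<le> real n * (\<Sum>i<n. (cmod (b i * fhat d (f i) k))\<^sup>2)"
      using cmod_sum_squared_le[of "\<lambda>i. b i * fhat d (f i) k" n] by (simp add: fhat_linear_combination[OF fH])
    also have "\<dots> \<le> real n * (\<Sum>i<n. (cmod (fhat d (f i) k) / real n)\<^sup>2)"
      using c n by (intro mult_left_mono sum_mono power_mono)
        (auto simp: b_def norm_mult norm_divide divide_right_mono mult_left_le_one_le)
    also have "\<dots> = (\<Sum>i<n. (1 / real n) * (cmod (fhat d (f i) k))\<^sup>2)"
      unfolding sum_distrib_left using n by (intro sum.cong) (auto simp: power_divide power2_eq_square)
    finally have "(cmod (fhat d ?g k))\<^sup>2 * (\<omega> d k)\<^sup>2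
        \<le> (\<Sum>i<n. (1 / real n) * (cmod (fhat d (f i) k))\<^sup>2) * (\<omega> d k)\<^sup>2"
      by (rule mult_right_mono) simp
    then show ?thesis by (simp add: sum_distrib_right)
  qed
  then have "(\<Sum>\<^sub>\<infinity>k\<in>Zd d. (cmod (fhat d ?g k))\<^sup>2 * (\<omega> d k)\<^sup>2) \<le> (\<Sum>i<n. (1 / real n) * s i)"
    by (intro has_sum_mono[OF lo up])
  also have "\<dots> \<le> (\<Sum>i<n. (1 / real n) * 1)"
    using s1 by (intro sum_mono mult_left_mono) auto
  also have "\<dots> = 1" using n by simp
  finally show ?thesis unfolding g using gH by (simp add: Hball_iff)
qed

lemma Hball_zero: "(\<lambda>_. 0) \<in> Hball \<omega> d"
  using Hspace_linear_combination[of 0 "\<lambda>_ _. 0"] by (simp add: Hball_def Hnorm_def fhat_def)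

section \<open>Absolute convergence of Fourier series and pointwise bounds\<close>

locale summable_weight =
  fixes \<omega> :: "nat \<Rightarrow> (nat \<Rightarrow> int) \<Rightarrow> real" and d :: nat
  assumes weight_pos: "k \<in> Zd d \<Longrightarrow> \<omega> d k > 0"
    and weight_summable: "(\<lambda>k. 1 / (\<omega> d k)\<^sup>2) summable_on Zd d"
begin

text \<open>Split each coefficient as a product of a weighted coefficient and a reciprocal weight,
  and apply \<open>2 * u * v \<le> u^2 + v^2\<close>. The free scale \<open>s\<close> replaces the
  Cauchy-Schwarz inequality for infinite sums and is chosen afterwards.\<close>

lemma Hspace_coefficients_summable:
  assumes f: "f \<in> Hspace \<omega> d" and s: "s > 0"
  shows "(\<lambda>k. cmod (fhat d f k)) summable_on Zd d"
    and "2 * (\<Sum>\<^sub>\<infinity>k\<in>Zd d. cmod (fhat d f k)) \<le> (Hnorm \<omega> d f)\<^sup>2 / s + s * (\<Sum>\<^sub>\<infinity>k\<in>Zd d. 1 / (\<omega> d k)\<^sup>2)"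
proof -
  have sf: "(\<lambda>k. (cmod (fhat d f k))\<^sup>2 * (\<omega> d k)\<^sup>2) summable_on Zd d"
    using f by (simp add: Hspace_def)
  have le: "cmod (fhat d f k) \<le> ((cmod (fhat d f k))\<^sup>2 * (\<omega> d k)\<^sup>2 * (1 / s) + s * (1 / (\<omega> d k)\<^sup>2)) / 2"
    if "k \<in> Zd d" for k
  proof -
    define u where "u = cmod (fhat d f k) * \<omega> d k / sqrt s"
    define v where "v = sqrt s / \<omega> d k"
    have "\<omega> d k > 0" using that by (rule weight_pos)
    then have uv: "u * v = cmod (fhat d f k)" using s by (simp add: u_def v_def)
    have "2 * (u * v) \<le> u\<^sup>2 + v\<^sup>2" using sum_squares_bound[of u v] by simp
    then show ?thesis unfolding uv using s by (simp add: u_def v_def power_divide power_mult_distrib)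
  qed
  have "((\<lambda>k. ((cmod (fhat d f k))\<^sup>2 * (\<omega> d k)\<^sup>2 * (1 / s) + s * (1 / (\<omega> d k)\<^sup>2)) * (1 / 2)) has_sum
      ((\<Sum>\<^sub>\<infinity>k\<in>Zd d. (cmod (fhat d f k))\<^sup>2 * (\<omega> d k)\<^sup>2) * (1 / s)
        + s * (\<Sum>\<^sub>\<infinity>k\<in>Zd d. 1 / (\<omega> d k)\<^sup>2)) * (1 / 2)) (Zd d)"
    using sf weight_summable by (intro has_sum_cmult_left has_sum_add has_sum_cmult_right has_sum_infsum)
  then have hs: "((\<lambda>k. ((cmod (fhat d f k))\<^sup>2 * (\<omega> d k)\<^sup>2 * (1 / s) + s * (1 / (\<omega> d k)\<^sup>2)) / 2) has_sum
      ((Hnorm \<omega> d f)\<^sup>2 / s + s * (\<Sum>\<^sub>\<infinity>k\<in>Zd d. 1 / (\<omega> d k)\<^sup>2)) / 2) (Zd d)"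
    by (simp add: Hnorm_def infsum_nonneg)
  show summ: "(\<lambda>k. cmod (fhat d f k)) summable_on Zd d"
    by (rule summable_on_comparison_test[OF has_sum_imp_summable[OF hs]]) (use le in auto)
  have "(\<Sum>\<^sub>\<infinity>k\<in>Zd d. cmod (fhat d f k))
      \<le> ((Hnorm \<omega> d f)\<^sup>2 / s + s * (\<Sum>\<^sub>\<infinity>k\<in>Zd d. 1 / (\<omega> d k)\<^sup>2)) / 2"
    by (rule has_sum_mono[OF has_sum_infsum[OF summ] hs]) (use le in auto)
  then show "2 * (\<Sum>\<^sub>\<infinity>k\<in>Zd d. cmod (fhat d f k)) \<le> (Hnorm \<omega> d f)\<^sup>2 / s + s * (\<Sum>\<^sub>\<infinity>k\<in>Zd d. 1 / (\<omega> d k)\<^sup>2)"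
    by simp
qed

lemma cmod_le_Hnorm:
  assumes f: "f \<in> Hspace \<omega> d" and x: "x \<in> space (torus d)"
  shows "cmod (f x) \<le> (1 + (\<Sum>\<^sub>\<infinity>k\<in>Zd d. 1 / (\<omega> d k)\<^sup>2)) / 2 * Hnorm \<omega> d f"
proof -
  define S where "S = (\<Sum>\<^sub>\<infinity>k\<in>Zd d. 1 / (\<omega> d k)\<^sup>2)"
  have S0: "S \<ge> 0" unfolding S_def by (intro infsum_nonneg) simp
  have N0: "Hnorm \<omega> d f \<ge> 0" by (simp add: Hnorm_def infsum_nonneg)
  have *: "2 * cmod (f x) \<le> (Hnorm \<omega> d f)\<^sup>2 / s + s * S" if "s > 0" for s
  proof -
    have "((\<lambda>k. fhat d f k * wave d k x) has_sum f x) (Zd d)"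
      using f x by (simp add: Hspace_def)
    moreover have "((\<lambda>k. norm (fhat d f k * wave d k x)) has_sum (\<Sum>\<^sub>\<infinity>k\<in>Zd d. cmod (fhat d f k))) (Zd d)"
      using has_sum_infsum[OF Hspace_coefficients_summable(1)[OF f that]] by (simp add: norm_mult)
    ultimately have "cmod (f x) \<le> (\<Sum>\<^sub>\<infinity>k\<in>Zd d. cmod (fhat d f k))"
      by (rule norm_has_sum_bound[rotated])
    then show ?thesis using Hspace_coefficients_summable(2)[OF f that] by (simp add: S_def)
  qed
  show ?thesis
  proof (cases "Hnorm \<omega> d f > 0")
    case True
    \<comment> \<open>The scale \<open>s\<close> equal to the norm makes the bound linear in the
      norm.\<close>
    then show ?thesis using *[OF True] unfolding S_def[symmetric] by (simp add: power2_eq_square field_simps)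
  next
    case False
    then have 0: "Hnorm \<omega> d f = 0" using N0 by simp
    have "cmod (f x) \<le> 0 + e" if "e > 0" for e
    proof -
      \<comment> \<open>The norm is zero and no longer a legal scale; arbitrarily small scales are
        used instead.\<close>
      have "e / (S + 1) > 0" using that S0 by simp
      from *[OF this] have "2 * cmod (f x) \<le> e * (S / (S + 1))" using 0 by simp
      also have "\<dots> \<le> e * 1" using that S0 by (intro mult_left_mono) auto
      finally show ?thesis using that by simp
    qed
    then have "cmod (f x) \<le> 0" by (rule field_le_epsilon)
    then show ?thesis using 0 by simp
  qed
qed

lemma Hball_bounded:
  assumes f: "f \<in> Hball \<omega> d" and x: "x \<in> space (torus d)"
  shows "cmod (f x) \<le> (1 + (\<Sum>\<^sub>\<infinity>k\<in>Zd d. 1 / (\<omega> d k)\<^sup>2)) / 2"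
proof -
  have "f \<in> Hspace \<omega> d" and N: "Hnorm \<omega> d f \<le> 1" using f by (auto simp: Hball_def)
  then have "cmod (f x) \<le> (1 + (\<Sum>\<^sub>\<infinity>k\<in>Zd d. 1 / (\<omega> d k)\<^sup>2)) / 2 * Hnorm \<omega> d f"
    using cmod_le_Hnorm[OF _ x] by blast
  also have "\<dots> \<le> (1 + (\<Sum>\<^sub>\<infinity>k\<in>Zd d. 1 / (\<omega> d k)\<^sup>2)) / 2 * 1"
    using N by (intro mult_left_mono) (auto intro!: add_nonneg_nonneg infsum_nonneg)
  finally show ?thesis by simp
qed

lemma Lstd_subset_Lall:
  "Lstd d \<subseteq> Lall \<omega> d"
  unfolding Lstd_def Lall_def using cmod_le_Hnorm by blast

text \<open>Elements of the space are continuous and boxes have positive measure, so the essential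
  supremum dominates every value.\<close>
lemma cmod_le_linf_dist:
  assumes f: "f \<in> Hspace \<omega> d" and x: "x \<in> space (torus d)"
  shows "ereal (cmod (f x)) \<le> linf_dist d f (\<lambda>_. 0)"
proof (rule ccontr)
  assume "\<not> ?thesis"
  then obtain r where r1: "linf_dist d f (\<lambda>_. 0) < ereal r" and "ereal r < ereal (cmod (f x))"
    using ereal_dense2[of "linf_dist d f (\<lambda>_. 0)" "ereal (cmod (f x))"] by (auto simp: not_le)
  then have r2: "r < cmod (f x)" by simp
  have ae: "AE y in torus d. cmod (f y) \<le> r"
    using esssup_AE[where M = "torus d" and f = "\<lambda>y. ereal (cmod (f y))"]
  proof eventually_elim
    case (elim y)
    have "esssup (torus d) (\<lambda>y. ereal (cmod (f y))) < ereal r" using r1 by (simp add: linf_dist_def)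
    with elim have "ereal (cmod (f y)) < ereal r" by (rule order.strict_trans1)
    then show ?case by simp
  qed
  \<comment> \<open>Shrinking boxes around \<open>x\<close>: each has positive measure and so
    contains a point where the almost everywhere bound \<open>r\<close> holds.\<close>
  define box where "box n = PiE {..<d} (\<lambda>j. {0..1} \<inter> {x j - 1 / real (Suc n)<..<x j + 1 / real (Suc n)})" for n
  have box: "box n \<subseteq> space (torus d)" for n by (auto simp: box_def space_torus PiE_iff)
  have "\<exists>y\<in>box n. cmod (f y) \<le> r" for n
  proof (rule ccontr)
    assume none: "\<not> ?thesis"
    have "AE y in torus d. \<not> y \<in> box n" using ae by eventually_elim (use none in blast)
    then have "emeasure (torus d) {y \<in> space (torus d). y \<in> box n} = 0"
      by (rule emeasure_eq_0_AE)
    moreover have "{y \<in> space (torus d). y \<in> box n} = box n" using box by blast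
    ultimately show False using emeasure_torus_box_pos[OF x, of "1 / real (Suc n)"] by (simp add: box_def)
  qed
  then obtain y where y: "\<And>n. y n \<in> box n" and yr: "\<And>n. cmod (f (y n)) \<le> r" by metis
  have lim: "(\<lambda>n. y n j) \<longlonglongrightarrow> x j" if "j < d" for j
  proof (rule LIMSEQ_I, goal_cases)
    case (1 e)
    then obtain N where N: "1 / real (Suc N) < e" using nat_approx_posE by blast
    have "norm (y n j - x j) < e" if "n \<ge> N" for n
    proof -
      have "y n j \<in> {0..1} \<inter> {x j - 1 / real (Suc n)<..<x j + 1 / real (Suc n)}"
        using PiE_mem[OF y[of n, unfolded box_def]] \<open>j < d\<close> by blast
      then have "\<bar>y n j - x j\<bar> < 1 / real (Suc n)" unfolding abs_less_iff by auto
      also have "\<dots> \<le> 1 / real (Suc N)" using that by (simp add: frac_le)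
      finally show ?thesis using N by simp
    qed
    then show ?case by blast
  qed
  \<comment> \<open>A third of the gap: the finite partial sum \<open>p\<close> is within
    \<open>e\<close> of \<open>f\<close> at both points, and continuity of \<open>p\<close> accounts
    for the remaining third.\<close>
  define e where "e = (cmod (f x) - r) / 3"
  have e: "e > 0" using r2 by (simp add: e_def)
  have "uniform_limit (space (torus d)) (\<lambda>F y. \<Sum>k\<in>F. fhat d f k * wave d k y) f (finite_subsets_at_top (Zd d))"
    by (rule Weierstrass_m_test_general'[where M = "\<lambda>k. cmod (fhat d f k)"])
      (use f Hspace_coefficients_summable(1)[OF f, of 1] in \<open>auto simp: norm_mult Hspace_def\<close>)
  then have "\<forall>\<^sub>F F in finite_subsets_at_top (Zd d). \<forall>y\<in>space (torus d).
      dist (\<Sum>k\<in>F. fhat d f k * wave d k y) (f y) < e"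
    using e by (rule uniform_limitD)
  then obtain F where F: "\<forall>y\<in>space (torus d). dist (\<Sum>k\<in>F. fhat d f k * wave d k y) (f y) < e"
    by (auto dest!: eventually_happens)
  define p where "p y = (\<Sum>k\<in>F. fhat d f k * wave d k y)" for y
  have "(\<lambda>n. p (y n)) \<longlonglongrightarrow> p x"
    unfolding p_def cis_conv_exp by (intro tendsto_intros) (use lim in auto)
  then obtain n where n: "dist (p (y n)) (p x) < e"
    using e by (metis LIMSEQ_iff_nz dist_commute lim_sequentially order_refl)
  have "dist (p (y n)) (f (y n)) < e" "dist (p x) (f x) < e"
    using F x y[of n] box[of n] by (auto simp: p_def)
  then have "dist (f x) (f (y n)) < 3 * e"
    using n by (smt (verit) dist_commute dist_triangle)
  then have "cmod (f x) < cmod (f (y n)) + 3 * e"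
    by (metis add.commute diff_less_eq dist_norm norm_triangle_ineq2 order_le_less_trans)
  then show False using yr[of n] by (simp add: e_def field_simps)
qed

end

section \<open>Comparison of the minimal errors\<close>

context summable_weight
begin

lemma bounded_function_class_Hball:
  "bounded_function_class (space (torus d)) (Hball \<omega> d) ((1 + (\<Sum>\<^sub>\<infinity>k\<in>Zd d. 1 / (\<omega> d k)\<^sup>2)) / 2)"
proof (rule bounded_function_class.intro)
  show "space (torus d) \<noteq> {}" by (rule space_torus_nonempty)
  show "(\<lambda>_. 0) \<in> Hball \<omega> d" by (rule Hball_zero)
  show "cmod (f x) \<le> (1 + (\<Sum>\<^sub>\<infinity>k\<in>Zd d. 1 / (\<omega> d k)\<^sup>2)) / 2"
    if "f \<in> Hball \<omega> d" "x \<in> space (torus d)" for f x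
    using that by (rule Hball_bounded)
  show "(\<lambda>x. (\<Sum>i<n. c i * f i x) / of_nat n) \<in> Hball \<omega> d"
    if "n > 0" "\<And>i. i < n \<Longrightarrow> cmod (c i) \<le> 1" "\<And>i. i < n \<Longrightarrow> f i \<in> Hball \<omega> d" for n c f
    using that by (rule Hball_average)
qed

lemma Hball_measurable: "f \<in> Hball \<omega> d \<Longrightarrow> f \<in> borel_measurable (torus d)"
  by (simp add: Hball_def Hspace_def)

text \<open>The algorithm returns any ball function with the observed samples. Half of its
  difference from \<open>f\<close> is a ball function vanishing at the points, and undoing the
  halving costs the factor 2.\<close>

lemma err_Lstd_le:
  assumes n: "n \<noteq> 0" and x: "\<And>i. i < n \<Longrightarrow> x i \<in> space (torus d)"
    and small: "\<And>h z. h \<in> Hball \<omega> d \<Longrightarrow> (\<forall>i<n. h (x i) = 0) \<Longrightarrow> z \<in> space (torus d) \<Longrightarrow> cmod (h z) \<le> b"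
  shows "err \<omega> d (Lstd d) n \<le> ereal (2 * b)"
proof -
  define \<phi> where "\<phi> ys = (SOME g. g \<in> Hball \<omega> d \<and> map (\<lambda>i. g (x i)) [0..<n] = ys)" for ys
  let ?p = "(\<lambda>i f. f (x i), \<phi>) :: (nat \<Rightarrow> functional) \<times> (complex list \<Rightarrow> (nat \<Rightarrow> real) \<Rightarrow> complex)"
  have "linf_dist d f (snd ?p (map (\<lambda>i. fst ?p i f) [0..<n])) \<le> ereal (2 * b)" if f: "f \<in> Hball \<omega> d" for f
  proof -
    define g where "g = \<phi> (map (\<lambda>i. f (x i)) [0..<n])"
    have "g \<in> Hball \<omega> d \<and> map (\<lambda>i. g (x i)) [0..<n] = map (\<lambda>i. f (x i)) [0..<n]"
      unfolding g_def \<phi>_def by (rule someI[of _ f]) (use f in simp)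
    then have g: "g \<in> Hball \<omega> d" and eq: "\<And>i. i < n \<Longrightarrow> g (x i) = f (x i)" by auto
    \<comment> \<open>Half the difference, written as a two-term average with coefficients 1 and -1
      to match \<open>Hball_average\<close>.\<close>
    define h where "h = (\<lambda>z. (\<Sum>i<2::nat. (if i = 0 then 1 else -1) * (if i = 0 then f else g) z) / of_nat 2)"
    have h: "h \<in> Hball \<omega> d"
      unfolding h_def by (rule Hball_average) (use f g in auto)
    have hz: "h z = (f z - g z) / 2" for z
      by (simp add: h_def numeral_2_eq_2)
    have le: "cmod (f z - g z) \<le> 2 * b" if "z \<in> space (torus d)" for z
      using small[OF h _ that] eq by (simp add: hz norm_divide)
    have "linf_dist d f g \<le> ereal (2 * b)"
      unfolding linf_dist_def
    proof (rule esssup_I)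
      show "(\<lambda>x. ereal (cmod (f x - g x))) \<in> borel_measurable (torus d)"
        using Hball_measurable[OF f] Hball_measurable[OF g] by measurable
      show "AE z in torus d. ereal (cmod (f z - g z)) \<le> ereal (2 * b)"
        by (intro AE_I2) (simp add: le)
    qed
    then show ?thesis by (simp add: g_def)
  qed
  then have "(SUP f\<in>Hball \<omega> d. linf_dist d f (snd ?p (map (\<lambda>i. fst ?p i f) [0..<n]))) \<le> ereal (2 * b)"
    by (intro SUP_least)
  moreover have "?p \<in> {(L, \<phi>). \<forall>i<n. L i \<in> Lstd d}" using x by (auto simp: Lstd_def)
  ultimately show ?thesis unfolding err_def if_not_P[OF n] by (rule INF_lower2[rotated])
qed

text \<open>A function \<open>f\<close> with vanishing information cannot be told apart from \<open>-f\<close>.\<close>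
lemma err_Lall_ge:
  assumes n: "n \<noteq> 0" and y: "\<And>i. i \<le> n \<Longrightarrow> y i \<in> space (torus d)" and g: "\<And>i. i \<le> n \<Longrightarrow> g i \<in> Hball \<omega> d"
    and cardinal: "\<And>i j. i \<le> n \<Longrightarrow> j \<le> n \<Longrightarrow> g i (y j) = (if i = j then of_real s else 0)" and s: "s \<ge> 0"
  shows "ereal (s / (real n + 1)) \<le> err \<omega> d (Lall \<omega> d) n"
proof -
  have "ereal (s / (real n + 1)) \<le> (SUP f\<in>Hball \<omega> d. linf_dist d f (\<phi> (map (\<lambda>i. L i f) [0..<n])))"
    (is "_ \<le> ?E") if L: "\<And>i. i < n \<Longrightarrow> L i \<in> Lall \<omega> d" for L :: "nat \<Rightarrow> functional" and \<phi>
  proof -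
    obtain c where c0: "\<forall>i<n. (\<Sum>j\<le>n. c j * L i (g j)) = 0" and c1: "\<forall>j\<le>n. cmod (c j) \<le> 1"
      and ck: "\<exists>j\<le>n. cmod (c j) = 1"
      using underdetermined_homogeneous_system[of n "\<lambda>i j. L i (g j)"] by blast
    obtain k where k: "k \<le> n" "cmod (c k) = 1" using ck by blast
    \<comment> \<open>The parameter \<open>e\<close> is a sign: \<open>F 1\<close> and
      \<open>F (-1)\<close> are opposite ball functions with zero information, so the algorithm
      answers both with the same \<open>G\<close>.\<close>
    define F where "F e = (\<lambda>z. (\<Sum>j<Suc n. (e * c j) * g j z) / of_nat (Suc n))" for e
    have FB: "F e \<in> Hball \<omega> d" if "cmod e = 1" for e
      unfolding F_def by (rule Hball_average) (use c1 g that in \<open>auto simp: norm_mult less_Suc_eq_le\<close>)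
    have gH: "g i \<in> Hspace \<omega> d" if "i < Suc n" for i using g that by (simp add: Hball_def less_Suc_eq_le)
    have LF: "L i (F e) = 0" if i: "i < n" for e i
    proof -
      have eq: "F e = (\<lambda>z. \<Sum>j<Suc n. (e * c j / of_nat (Suc n)) * g j z)"
        unfolding F_def sum_divide_distrib by (intro ext sum.cong) auto
      have "L i (F e) = (\<Sum>j<Suc n. (e * c j / of_nat (Suc n)) * L i (g j))"
        unfolding eq using L[OF i] gH by (rule Lall_linear_combination)
      also have "\<dots> = (e / of_nat (Suc n)) * (\<Sum>j\<le>n. c j * L i (g j))"
        unfolding sum_distrib_left lessThan_Suc_atMost by (intro sum.cong) auto
      finally show ?thesis using c0 i by simp
    qed
    define f where "f = F 1"
    have fB: "f \<in> Hball \<omega> d" by (simp add: f_def FB)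
    have neg: "F (-1) z = - f z" for z
      unfolding f_def F_def minus_divide_left sum_negf[symmetric] by (simp del: sum.lessThan_Suc of_nat_Suc)
    define G where "G = \<phi> (map (\<lambda>i. 0) [0..<n])"
    have info: "map (\<lambda>i. L i (F e)) [0..<n] = map (\<lambda>i. 0) [0..<n]" for e
      by (rule map_cong) (auto simp: LF)
    have FE: "linf_dist d (F e) G \<le> ?E" if "cmod e = 1" for e
      using SUP_upper[of "F e" "Hball \<omega> d" "\<lambda>f. linf_dist d f (\<phi> (map (\<lambda>i. L i f) [0..<n]))"] FB[OF that]
      unfolding info G_def by blast
    \<comment> \<open>Arguing pointwise almost everywhere also covers a non-measurable
      \<open>G\<close>, whose distance to a measurable function is infinite.\<close>
    have "AE z in torus d. ereal (cmod (f z)) \<le> ?E"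
      using esssup_AE[where M = "torus d" and f = "\<lambda>z. ereal (cmod (f z - G z))"]
        esssup_AE[where M = "torus d" and f = "\<lambda>z. ereal (cmod (F (-1) z - G z))"]
    proof eventually_elim
      case (elim z)
      have a: "ereal (cmod (f z - G z)) \<le> ?E"
        using order.trans[OF elim(1)] FE[of 1] by (simp add: f_def linf_dist_def)
      have b: "ereal (cmod (F (-1) z - G z)) \<le> ?E"
        using order.trans[OF elim(2)] FE[of "-1"] by (simp add: linf_dist_def)
      have "2 * f z = (f z - G z) - (F (-1) z - G z)" by (simp add: neg)
      then have "cmod (2 * f z) \<le> cmod (f z - G z) + cmod (F (-1) z - G z)"
        by (metis norm_triangle_ineq4)
      then have "cmod (f z) \<le> max (cmod (f z - G z)) (cmod (F (-1) z - G z))"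
        by (simp add: norm_mult max_def split: if_splits)
      then have "ereal (cmod (f z)) \<le> max (ereal (cmod (f z - G z))) (ereal (cmod (F (-1) z - G z)))"
        by (simp add: max_def split: if_splits)
      also have "\<dots> \<le> ?E" using a b by simp
      finally show ?case .
    qed
    then have upper: "linf_dist d f (\<lambda>_. 0) \<le> ?E"
      unfolding linf_dist_def using Hball_measurable[OF fB] by (intro esssup_I) (simp_all, measurable)
    have lower: "ereal (cmod (f (y k))) \<le> linf_dist d f (\<lambda>_. 0)"
      by (rule cmod_le_linf_dist) (use fB y k in \<open>auto simp: Hball_def\<close>)
    have "f (y k) = c k * of_real s / of_nat (Suc n)"
    proof -
      \<comment> \<open>At \<open>y k\<close> only the term with the coefficient of modulus 1
        survives.\<close>
      have "(\<Sum>j<Suc n. 1 * c j * g j (y k)) = (\<Sum>j<Suc n. if j = k then c k * of_real s else 0)"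
        using k by (intro sum.cong) (auto simp: cardinal)
      also have "\<dots> = c k * of_real s" using k by (simp del: sum.lessThan_Suc)
      finally show ?thesis by (simp add: f_def F_def del: sum.lessThan_Suc of_nat_Suc)
    qed
    then have value_at: "cmod (f (y k)) = s / (real n + 1)"
      using k s by (simp add: norm_mult norm_divide add.commute del: of_nat_Suc)
    show ?thesis using lower upper unfolding value_at by (rule order.trans)
  qed
  then show ?thesis unfolding err_def if_not_P[OF n] by (intro INF_greatest) auto
qed

lemma init_err_nonneg: "0 \<le> init_err \<omega> d"
proof -
  obtain z where z: "z \<in> space (torus d)" using space_torus_nonempty by blast
  have "0 \<le> linf_dist d (\<lambda>_. 0) (\<lambda>_. 0)"
    using cmod_le_linf_dist[of "\<lambda>_. 0", OF _ z] Hball_zero[of \<omega> d] by (simp add: Hball_def zero_ereal_def)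
  also have "\<dots> \<le> init_err \<omega> d"
    unfolding init_err_def by (rule SUP_upper) (rule Hball_zero)
  finally show ?thesis .
qed

text \<open>The bounds are \<open>4 * t\<close> from above and \<open>t / (2 * (n + 1)^2)\<close>
  from below: one factor \<open>n + 1\<close> comes from averaging cofactors, the other from
  averaging cardinal functions.\<close>

theorem err_Lstd_le_err_Lall:
  "err \<omega> d (Lstd d) n \<le> ereal (8 * (real n + 1)\<^sup>2) * err \<omega> d (Lall \<omega> d) n"
proof (cases "n = 0")
  case True
  \<comment> \<open>Without information both errors are the initial error.\<close>
  have "1 * init_err \<omega> d \<le> ereal 8 * init_err \<omega> d"
    by (intro ereal_mult_right_mono init_err_nonneg) simp
  then show ?thesis using True by (simp add: err_def)
next
  case False
  interpret bounded_function_class "space (torus d)" "Hball \<omega> d" "(1 + (\<Sum>\<^sub>\<infinity>k\<in>Zd d. 1 / (\<omega> d k)\<^sup>2)) / 2"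
    by (rule bounded_function_class_Hball)
  obtain t where *: "t \<ge> 0 \<and> (\<exists>x. (\<forall>i<n. x i \<in> space (torus d)) \<and>
        (\<forall>h\<in>Hball \<omega> d. (\<forall>i<n. h (x i) = 0) \<longrightarrow> (\<forall>z\<in>space (torus d). cmod (h z) \<le> 2 * t))) \<and>
      (\<exists>y g. (\<forall>i\<le>n. y i \<in> space (torus d) \<and> g i \<in> Hball \<omega> d) \<and> (\<forall>i\<le>n. \<forall>j\<le>n.
        g i (y j) = (if i = j then of_real (t / (2 * (real n + 1))) else 0)))"
    using sampling_points_and_cardinal_functions[of n] ..
  note t = *[THEN conjunct1] and 1 = *[THEN conjunct2, THEN conjunct1] and 2 = *[THEN conjunct2, THEN conjunct2]
  have up: "err \<omega> d (Lstd d) n \<le> ereal (2 * (2 * t))"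
    using 1 by (elim exE conjE) (rule err_Lstd_le[OF False], auto)
  have lo: "ereal (t / (2 * (real n + 1)) / (real n + 1)) \<le> err \<omega> d (Lall \<omega> d) n"
    using 2 t by (elim exE conjE) (rule err_Lall_ge[OF False], auto)
  have "2 * (2 * t) = 8 * r\<^sup>2 * (t / (2 * r) / r)" if "r \<noteq> 0" for r :: real
    using that by (simp add: power2_eq_square)
  from this[of "real n + 1"] have "ereal (2 * (2 * t)) = ereal (8 * (real n + 1)\<^sup>2) * ereal (t / (2 * (real n + 1)) / (real n + 1))"
    by simp
  also have "\<dots> \<le> ereal (8 * (real n + 1)\<^sup>2) * err \<omega> d (Lall \<omega> d) n"
    by (intro ereal_mult_left_mono lo) simp
  finally show ?thesis using up by (rule order.trans[rotated])
qed

lemma err_Lall_le_err_Lstd: "err \<omega> d (Lall \<omega> d) n \<le> err \<omega> d (Lstd d) n"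
proof (cases "n = 0")
  case False
  have "{(L, \<phi>). \<forall>i<n. L i \<in> Lstd d} \<subseteq> {(L, \<phi>). \<forall>i<n. L i \<in> Lall \<omega> d}"
    using Lstd_subset_Lall by auto
  then show ?thesis unfolding err_def if_not_P[OF False] by (rule INF_superset_mono) (rule order_refl)
qed (simp add: err_def)

lemma nstar_Lall_le_nstar_Lstd: "nstar \<omega> c (Lall \<omega>) \<epsilon> d \<le> nstar \<omega> c Lstd \<epsilon> d"
  unfolding nstar_def by (rule Inf_superset_mono) (auto intro: order.trans[OF err_Lall_le_err_Lstd])

lemma CRI_nonneg: "0 \<le> CRI \<omega> c d"
  using init_err_nonneg by (cases c) (auto simp: CRI_def)

text \<open>The number of functionals stays \<open>m\<close>; only the accuracy pays for the change
  of information. Both criteria are covered because \<open>CRI\<close> enters only as a nonnegative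
  factor common to both classes.\<close>

lemma nstar_Lstd_le:
  assumes m: "nstar \<omega> c (Lall \<omega>) \<epsilon>' d = enat m" and le: "8 * (real m + 1)\<^sup>2 * \<epsilon>' \<le> \<epsilon>"
  shows "nstar \<omega> c Lstd \<epsilon> d \<le> enat m"
proof -
  let ?A = "{enat n |n. err \<omega> d (Lall \<omega> d) n \<le> ereal \<epsilon>' * CRI \<omega> c d}"
  \<comment> \<open>The empty infimum in \<open>enat\<close> is infinity, so a finite value means
    that the infimum is attained.\<close>
  have "?A \<noteq> {}"
  proof
    assume "?A = {}"
    then have "nstar \<omega> c (Lall \<omega>) \<epsilon>' d = Inf {}" unfolding nstar_def by (rule arg_cong)
    then show False using m by (simp add: Inf_enat_def)
  qed
  then have "Inf ?A \<in> ?A" unfolding Inf_enat_def by (metis (no_types, lifting) LeastI_ex ex_in_conv)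
  then have all: "err \<omega> d (Lall \<omega> d) m \<le> ereal \<epsilon>' * CRI \<omega> c d"
    using m by (auto simp: nstar_def)
  have "err \<omega> d (Lstd d) m \<le> ereal (8 * (real m + 1)\<^sup>2) * err \<omega> d (Lall \<omega> d) m"
    by (rule err_Lstd_le_err_Lall)
  also have "\<dots> \<le> ereal (8 * (real m + 1)\<^sup>2) * (ereal \<epsilon>' * CRI \<omega> c d)"
    by (intro ereal_mult_left_mono all) simp
  also have "\<dots> = ereal (8 * (real m + 1)\<^sup>2 * \<epsilon>') * CRI \<omega> c d"
    by (simp add: mult.assoc[symmetric])
  also have "\<dots> \<le> ereal \<epsilon> * CRI \<omega> c d"
    by (intro ereal_mult_right_mono CRI_nonneg) (simp add: le)
  finally show ?thesis unfolding nstar_def by (intro Inf_lower) blast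
qed

end

text \<open>For exponents between 0 and 1, \<open>(1 + b / a) powr p\<close> is at most
  \<open>1 + b / a\<close>, and \<open>a powr p\<close> at most \<open>a\<close>. An additive loss
  in the logarithm of the accuracy thus remains additive under the power.\<close>

lemma powr_add_le:
  fixes a b p :: real
  assumes "a \<ge> 1" "b \<ge> 0" "p \<le> 1"
  shows "(a + b) powr p \<le> a powr p + b"
proof (cases "p \<ge> 0")
  case True
  have "a + b = a * (1 + b / a)" using assms by (simp add: field_simps)
  then have "(a + b) powr p = a powr p * (1 + b / a) powr p"
    using assms by (simp only: powr_mult)
  also have "\<dots> \<le> a powr p * (1 + b / a)"
    using assms powr_mono[of p 1 "1 + b / a"] by (intro mult_left_mono) auto
  also have "\<dots> = a powr p + b * (a powr p / a powr 1)"
    using assms by (simp add: field_simps)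
  also have "\<dots> \<le> a powr p + b * 1"
    using assms powr_mono[of p 1 a] by (intro add_left_mono mult_left_mono) auto
  finally show ?thesis by simp
next
  case False
  have "(a + b) powr p \<le> a powr p" using assms False by (intro powr_mono2') auto
  then show ?thesis using assms by simp
qed

section \<open>Transfer of exponential uniform weak tractability\<close>

theorem theorem4p5:
  fixes \<omega> :: "nat \<Rightarrow> (nat \<Rightarrow> int) \<Rightarrow> real" and c :: crit
  assumes "\<forall>d\<ge>1. \<forall>k\<in>Zd d. \<omega> d k > 0"
    and "\<forall>d\<ge>1. (\<lambda>k. 1 / (\<omega> d k)\<^sup>2) summable_on Zd d"
  shows "EXP_UWT \<omega> c (Lall \<omega>) \<longleftrightarrow> EXP_UWT \<omega> c Lstd"
proof
  have weight: "summable_weight \<omega> d" if "d \<ge> 1" for d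
    using assms that by unfold_locales auto
  have ln_pos: "0 < (1 + ln (1 / \<epsilon>)) powr \<alpha> + real d powr \<beta>" if "0 < \<epsilon>" "\<epsilon> < 1" "d \<ge> 1" for \<epsilon> \<alpha> \<beta> d
    using that by (intro add_nonneg_pos) auto
  {
    assume std: "EXP_UWT \<omega> c Lstd"
    show "EXP_UWT \<omega> c (Lall \<omega>)"
      unfolding EXP_UWT_def
    proof (intro allI impI)
      fix \<alpha> \<beta> \<delta> :: real assume "0 < \<alpha>" "0 < \<beta>" "0 < \<delta>"
      then obtain R where R: "\<And>d \<epsilon>. d \<ge> 1 \<Longrightarrow> 0 < \<epsilon> \<and> \<epsilon> < 1 \<and> 1 / \<epsilon> + real d > R \<Longrightarrow>
          nstar \<omega> c Lstd \<epsilon> d \<noteq> \<infinity> \<and> ln (max 1 (real (the_enat (nstar \<omega> c Lstd \<epsilon> d))))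
            / ((1 + ln (1 / \<epsilon>)) powr \<alpha> + real d powr \<beta>) \<le> \<delta>"
        using std unfolding EXP_UWT_def by meson
      show "\<exists>R. \<forall>d\<ge>1. \<forall>\<epsilon>. 0 < \<epsilon> \<and> \<epsilon> < 1 \<and> 1 / \<epsilon> + real d > R \<longrightarrow>
          nstar \<omega> c (Lall \<omega>) \<epsilon> d \<noteq> \<infinity> \<and> ln (max 1 (real (the_enat (nstar \<omega> c (Lall \<omega>) \<epsilon> d))))
            / ((1 + ln (1 / \<epsilon>)) powr \<alpha> + real d powr \<beta>) \<le> \<delta>"
      \<comment> \<open>The same threshold works, since general information never needs more
        functionals.\<close>
      proof (intro exI[of _ R] allI impI)
        fix d :: nat and \<epsilon> :: real assume d: "1 \<le> d" and \<epsilon>: "0 < \<epsilon> \<and> \<epsilon> < 1 \<and> 1 / \<epsilon> + real d > R"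
        obtain m where m: "nstar \<omega> c Lstd \<epsilon> d = enat m" using R[OF d \<epsilon>] by auto
        moreover have "nstar \<omega> c (Lall \<omega>) \<epsilon> d \<le> nstar \<omega> c Lstd \<epsilon> d"
          by (rule summable_weight.nstar_Lall_le_nstar_Lstd[OF weight[OF d]])
        ultimately obtain l where l: "nstar \<omega> c (Lall \<omega>) \<epsilon> d = enat l" "l \<le> m"
          by (metis enat_ile enat_ord_simps(1))
        have "ln (max 1 (real l)) / ((1 + ln (1 / \<epsilon>)) powr \<alpha> + real d powr \<beta>)
            \<le> ln (max 1 (real m)) / ((1 + ln (1 / \<epsilon>)) powr \<alpha> + real d powr \<beta>)"
          using l(2) ln_pos[of \<epsilon> d] \<epsilon> d by (intro divide_right_mono) (auto intro: less_imp_le)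
        then show "nstar \<omega> c (Lall \<omega>) \<epsilon> d \<noteq> \<infinity> \<and> ln (max 1 (real (the_enat (nstar \<omega> c (Lall \<omega>) \<epsilon> d))))
            / ((1 + ln (1 / \<epsilon>)) powr \<alpha> + real d powr \<beta>) \<le> \<delta>"
          using R[OF d \<epsilon>] l m by simp
      qed
    qed
  next
    assume all: "EXP_UWT \<omega> c (Lall \<omega>)"
    show "EXP_UWT \<omega> c Lstd"
      unfolding EXP_UWT_def
    proof (intro allI impI)
      fix \<alpha> \<beta> \<delta> :: real assume \<alpha>: "0 < \<alpha>" and \<beta>: "0 < \<beta>" and \<delta>: "0 < \<delta>"
      \<comment> \<open>The exponent is capped at 1 for \<open>powr_add_le\<close>; \<delta>' is
        chosen so that \<open>\<delta>' * (3 + 2 * \<delta>) = \<delta>\<close>.\<close>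
      define \<alpha>' where "\<alpha>' = min \<alpha> 1"
      define \<delta>' where "\<delta>' = \<delta> / (3 + 2 * \<delta>)"
      have "0 < \<alpha>'" "0 < \<delta>'" using \<alpha> \<delta> by (auto simp: \<alpha>'_def \<delta>'_def)
      then obtain R where R: "\<And>d \<epsilon>. d \<ge> 1 \<Longrightarrow> 0 < \<epsilon> \<and> \<epsilon> < 1 \<and> 1 / \<epsilon> + real d > R \<Longrightarrow>
          nstar \<omega> c (Lall \<omega>) \<epsilon> d \<noteq> \<infinity> \<and> ln (max 1 (real (the_enat (nstar \<omega> c (Lall \<omega>) \<epsilon> d))))
            / ((1 + ln (1 / \<epsilon>)) powr \<alpha>' + real d powr \<beta>) \<le> \<delta>'"
        using all \<beta> unfolding EXP_UWT_def by meson
      show "\<exists>R. \<forall>d\<ge>1. \<forall>\<epsilon>. 0 < \<epsilon> \<and> \<epsilon> < 1 \<and> 1 / \<epsilon> + real d > R \<longrightarrow>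
          nstar \<omega> c Lstd \<epsilon> d \<noteq> \<infinity> \<and> ln (max 1 (real (the_enat (nstar \<omega> c Lstd \<epsilon> d))))
            / ((1 + ln (1 / \<epsilon>)) powr \<alpha> + real d powr \<beta>) \<le> \<delta>"
      proof (intro exI[of _ R] allI impI)
        fix d :: nat and \<epsilon> :: real assume d: "1 \<le> d" and \<epsilon>: "0 < \<epsilon> \<and> \<epsilon> < 1 \<and> 1 / \<epsilon> + real d > R"
        define a where "a = 1 + ln (1 / \<epsilon>)"
        define X where "X = a powr \<alpha>' + real d powr \<beta>"
        \<comment> \<open>\<open>T\<close> is the bound aimed at for the number of functionals. It
          fixes \<epsilon>' before \<open>m\<close> is known, and the hypothesis at \<epsilon>' then
          yields \<open>m \<le> T\<close>, which closes the circle.\<close>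
        define T where "T = exp (\<delta> * X)"
        define \<epsilon>' where "\<epsilon>' = \<epsilon> / (8 * (T + 1)\<^sup>2)"
        have a1: "a \<ge> 1" using \<epsilon> by (simp add: a_def)
        have X2: "X \<ge> 2"
          using ge_one_powr_ge_zero[OF a1, of \<alpha>'] ge_one_powr_ge_zero[of "real d" \<beta>] d \<beta> \<open>0 < \<alpha>'\<close>
          by (simp add: X_def)
        have T1: "T \<ge> 1" using \<delta> X2 by (simp add: T_def)
        have den: "8 * (T + 1)\<^sup>2 \<ge> 1" using T1 one_le_power[of "T + 1" 2] by linarith
        have \<epsilon>'_pos: "\<epsilon>' > 0" unfolding \<epsilon>'_def using \<epsilon> den by (intro divide_pos_pos) linarith+
        have \<epsilon>'_le: "\<epsilon>' \<le> \<epsilon>" using \<epsilon> den by (simp add: \<epsilon>'_def divide_le_eq mult_le_cancel_left1)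
        have "1 / \<epsilon> \<le> 1 / \<epsilon>'" using \<epsilon>'_pos \<epsilon>'_le by (simp add: frac_le)
        then have ok: "0 < \<epsilon>' \<and> \<epsilon>' < 1 \<and> 1 / \<epsilon>' + real d > R" using \<epsilon> \<epsilon>'_pos \<epsilon>'_le by auto
        obtain m where m: "nstar \<omega> c (Lall \<omega>) \<epsilon>' d = enat m" using R[OF d ok] by auto
        have "ln (max 1 (real m)) / ((1 + ln (1 / \<epsilon>')) powr \<alpha>' + real d powr \<beta>) \<le> \<delta>'"
          using R[OF d ok] m by simp
        then have lm: "ln (max 1 (real m)) \<le> \<delta>' * ((1 + ln (1 / \<epsilon>')) powr \<alpha>' + real d powr \<beta>)"
          using ln_pos[of \<epsilon>' d \<alpha>' \<beta>] ok d by (simp add: divide_le_eq)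
        have "1 + ln (1 / \<epsilon>') = a + ln (8 * (T + 1)\<^sup>2)"
          using \<epsilon> T1 by (simp add: \<epsilon>'_def a_def ln_div)
        \<comment> \<open>As \<open>T\<close> is at least 1, \<open>T + 1\<close> is at most
          \<open>2 * T\<close>; this splits the logarithm into a constant and
          \<open>2 * (\<delta> * X)\<close>.\<close>
        also have "ln (8 * (T + 1)\<^sup>2) \<le> ln (8 * (2 * T)\<^sup>2)"
          using T1 by (intro ln_mono mult_left_mono power_mono) auto
        also have "ln (8 * (2 * T)\<^sup>2) = ln 32 + 2 * (\<delta> * X)"
          by (simp add: power_mult_distrib ln_mult T_def power2_eq_square)
        also have "ln (32::real) \<le> 4"
        proof -
          have "(32::real) = 2 ^ 5" by simp
          then have "ln (32::real) = 5 * ln 2" by (metis ln_realpow of_nat_numeral zero_less_numeral)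
          then show ?thesis using ln2_le_25_over_36 by simp
        qed
        finally have "1 + ln (1 / \<epsilon>') \<le> a + (4 + 2 * (\<delta> * X))" by simp
        then have "(1 + ln (1 / \<epsilon>')) powr \<alpha>' \<le> (a + (4 + 2 * (\<delta> * X))) powr \<alpha>'"
          using ok \<open>0 < \<alpha>'\<close> by (intro powr_mono2) auto
        also have "\<dots> \<le> a powr \<alpha>' + (4 + 2 * (\<delta> * X))"
          using a1 \<delta> X2 by (intro powr_add_le) (auto simp: \<alpha>'_def)
        finally have "(1 + ln (1 / \<epsilon>')) powr \<alpha>' + real d powr \<beta> \<le> X + (4 + 2 * (\<delta> * X))"
          by (simp add: X_def)
        \<comment> \<open>The constant 4 is absorbed by \<open>2 * X\<close>, because both summands
          of \<open>X\<close> are at least 1.\<close>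
        also have "\<dots> \<le> (3 + 2 * \<delta>) * X" using X2 by (simp add: algebra_simps)
        finally have "ln (max 1 (real m)) \<le> \<delta>' * ((3 + 2 * \<delta>) * X)"
          using lm \<open>0 < \<delta>'\<close> by (meson less_imp_le mult_left_mono order_trans)
        also have "\<dots> = \<delta> * X" using \<delta> by (simp add: \<delta>'_def)
        finally have lmX: "ln (max 1 (real m)) \<le> \<delta> * X" .
        then have "exp (ln (max 1 (real m))) \<le> T" unfolding T_def by (rule exp_le_cancel_iff[THEN iffD2])
        then have "max 1 (real m) \<le> T" by (subst (asm) exp_ln) auto
        then have "8 * (real m + 1)\<^sup>2 \<le> 8 * (T + 1)\<^sup>2" by (intro mult_left_mono power_mono) auto
        then have "8 * (real m + 1)\<^sup>2 * \<epsilon>' \<le> 8 * (T + 1)\<^sup>2 * \<epsilon>'"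
          using \<epsilon>'_pos by (intro mult_right_mono) auto
        also have "\<dots> = \<epsilon>" using T1 by (simp add: \<epsilon>'_def)
        finally have "nstar \<omega> c Lstd \<epsilon> d \<le> enat m"
          by (rule summable_weight.nstar_Lstd_le[OF weight[OF d] m])
        then obtain l where l: "nstar \<omega> c Lstd \<epsilon> d = enat l" "l \<le> m"
          by (metis enat_ile enat_ord_simps(1))
        have "ln (max 1 (real l)) \<le> ln (max 1 (real m))" using l(2) by simp
        also note lmX
        \<comment> \<open>Back to the original exponent: \<open>a\<close> is at least 1 and
          \<alpha>' at most \<alpha>.\<close>
        also have "\<delta> * X \<le> \<delta> * (a powr \<alpha> + real d powr \<beta>)"
          unfolding X_def using \<delta> a1 by (intro mult_left_mono add_right_mono powr_mono) (auto simp: \<alpha>'_def)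
        finally have "ln (max 1 (real l)) / (a powr \<alpha> + real d powr \<beta>) \<le> \<delta>"
          using ln_pos[of \<epsilon> d \<alpha> \<beta>] \<epsilon> d by (simp add: divide_le_eq a_def)
        then show "nstar \<omega> c Lstd \<epsilon> d \<noteq> \<infinity> \<and> ln (max 1 (real (the_enat (nstar \<omega> c Lstd \<epsilon> d))))
            / ((1 + ln (1 / \<epsilon>)) powr \<alpha> + real d powr \<beta>) \<le> \<delta>"
          using l by (simp add: a_def)
      qed
    qed
  }
qed

end
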